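(* Suppose that (A1) the feasible set of the SISDP is nonempty and compact, and (A2) the Slater constraint qualification holds for the SISDP. Let $\{(x^k,y^k,V_k)\}$ be an infinite sequence produced by Algorithm 1. Then $\{(x^k,y^k,V_k)\}\subseteq\mathbb{R}^n\times\mathcal{M}(T)\times S^m$ is bounded. Moreover, let $(x^\ast,y^\ast,V_\ast)\in\mathbb{R}^n\times\mathcal{M}_+(T)\times S^m$ be a weak$^\ast$ accumulation point of $\{(x^k,y^k,V_k)\}$. Then $(x^\ast,y^\ast,V_\ast)$ is a KKT point of the SISDP. In particular, if $f$ is convex, then $x^\ast$ is an optimum of the SISDP.
   Context: Notation. $S^m$, $S^m_+$, $S^m_{++}$ are the sets of real symmetric, symmetric positive semidefinite, symmetric positive definite $m\times m$ matrices; $X\circ Y=(XY+YX)/2$, $X\bullet Y=\mathrm{Tr}(XY)$ for $X,Y\in S^m$; $\mathrm{svec}(X)=(X_{11},\sqrt2X_{21},\ldots,\sqrt2X_{m1},X_{22},\sqrt2X_{32},\ldots,X_{mm})^\top$; $(\zeta)_+=\max(\zeta,0)$; $(F_i\bullet V)_{i=1}^n=(F_1\bullet V,\ldots,F_n\bullet V)^\top$. $T$ is a compact metric space; $\mathcal{M}(T)$ is the space of finite signed regular Borel measures on $T$ (the dual of the space $\mathcal{C}(T)$ of continuous real functions with sup norm), with the total variation norm, and $\mathcal{M}_+(T)$ is the set of its nonnegative elements. Weak$^\ast$ convergence on $\mathcal{M}(T)$ is with respect to the pairing $\langle y,h\rangle=\int_T h\,dy$, $h\in\mathcal{C}(T)$;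 weak$^\ast$ accumulation points of triples are with respect to the product of the weak$^\ast$ topology on $\mathcal{M}(T)$ and the usual topologies on $\mathbb{R}^n$ and $S^m$. Problem (SISDP). Minimize $f(x)$ over $x\in\mathbb{R}^n$ subject to $g(x,\tau)\le0$ for all $\tau\in T$ and $F(x)\in S^m_+$, where $f:\mathbb{R}^n\to\mathbb{R}$ is continuously differentiable, $g:\mathbb{R}^n\times T\to\mathbb{R}$ is continuous with $g(\cdot,\tau)$ convex and continuously differentiable for every $\tau$, and $F(x)=F_0+\sum_{i=1}^nx_iF_i$ with $F_0,\ldots,F_n\in S^m$. The SISDP is assumed to have a nonempty solution set. The Slater constraint qualification means: there is $\bar x\in\mathbb{R}^n$ with $F(\bar x)\in S^m_{++}$ and $g(\bar x,\tau)<0$ for all $\tau\in T$. KKT point: a triple $(x,y,V)$ with $\nabla f(x)+\int_T\nabla_xg(x,\tau)\,dy(\tau)-(F_i\bullet V)_{i=1}^n=0$; $F(x)\circ V=O$, $F(x)\in S^m_+$, $V\in S^m_+$; $\int_Tg(x,\tau)\,dy(\tau)=0$, $g(x,\tau)\le0$ $(\tau\in T)$, $y\in\mathcal{M}_+(T)$. For $\mu\ge0$ let $R_\mu(x,y,V)=\sqrt{\theta(x)^2+\|\phi_1(x,y,V)\|^2+\phi_2(x,y)^2+\|\phi_3(x,V,\mu)\|^2}$, where $\theta(x)=\max_{\tau\in T}(g(x,\tau))_+$, $\phi_1(x,y,V)=\nabla f(x)+\int_T\nabla_xg(x,\tau)\,dy(\tau)-(F_i\bullet V)_{i=1}^n$,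 $\phi_2(x,y)=\int_Tg(x,\tau)\,dy(\tau)$, $\phi_3(x,V,\mu)=\mathrm{svec}(F(x)\circ V-\mu I)$. For $\varepsilon>0$ let $\mathcal{N}_\mu^\varepsilon=\{(x,y,V)\in\mathbb{R}^n\times\mathcal{M}_+(T)\times S^m_{++}: R_\mu(x,y,V)\le\varepsilon,\ F(x)\in S^m_{++}\}$. Algorithm 1. Choose $w^0=(x^0,y^0,V_0)$ with $y^0\in\mathcal{M}_+(T)$, $F(x^0)\in S^m_{++}$, $V_0\in S^m_{++}$, and $\mu_0>0$, $\varepsilon_0>0$, $\beta\in(0,1)$. For $k=0,1,2,\ldots$: stop if $R_0(w^k)=0$, $F(x^k)\in S^m_+$, $V_k\in S^m_+$, $y^k\in\mathcal{M}_+(T)$; otherwise find a point $w^{k+1}=(x^{k+1},y^{k+1},V_{k+1})\in\mathcal{N}_{\mu_k}^{\varepsilon_k}$ (it is assumed that such a point can always be found), and set $\mu_{k+1}=\beta\mu_k$, $\varepsilon_{k+1}=\beta\varepsilon_k$. It is assumed that the algorithm does not stop, so that it produces an infinite sequence. *)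

theory Defs
  imports "HOL-Analysis.Analysis"
begin

type_synonym 'm sqmat = "((real, 'm) vec, 'm) vec"

definition sym_mats :: "(real^'m^'m) set" where
  "sym_mats = {X. transpose X = X}"

definition psd_mats :: "(real^'m^'m) set" where
  "psd_mats = {X \<in> sym_mats. \<forall>v. 0 \<le> v \<bullet> (X *v v)}"

definition pd_mats :: "(real^'m^'m) set" where
  "pd_mats = {X \<in> sym_mats. \<forall>v. v \<noteq> 0 \<longrightarrow> 0 < v \<bullet> (X *v v)}"

definition jordan_prod :: "real^'m^'m \<Rightarrow> real^'m^'m \<Rightarrow> real^'m^'m" where
  "jordan_prod X Y = (1/2) *\<^sub>R (X ** Y + Y ** X)"

definition mat_inner :: "real^'m^'m \<Rightarrow> real^'m^'m \<Rightarrow> real" where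
  "mat_inner X Y = trace (X ** Y)"

text \<open>The entries of \<open>svec X\<close> are indexed by the positions \<open>(i, j)\<close> of the lower triangle rather
  than by \<open>1, \<dots>, m (m + 1) / 2\<close>; the Euclidean norm does not depend on the enumeration.\<close>

definition lower_triangle :: "('m::{finite,linorder} \<times> 'm) set" where
  "lower_triangle = {(i, j). j \<le> i}"

definition svec :: "'m::{finite,linorder} sqmat \<Rightarrow> 'm \<times> 'm \<Rightarrow> real" where
  "svec X = (\<lambda>(i, j). if i = j then X $ i $ j else sqrt 2 * X $ i $ j)"

definition svec_norm :: "('m::{finite,linorder} \<times> 'm \<Rightarrow> real) \<Rightarrow> real" where
  "svec_norm s = L2_set s lower_triangle"


abbreviation borel_sets :: "'a::topological_space set \<Rightarrow> 'a set set" where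
  "borel_sets T \<equiv> sets (restrict_space borel T)"

text \<open>A signed measure on \<open>T\<close> is a real set function; outside the Borel sets of \<open>T\<close> it is 0 by
  convention, so that equality of signed measures is equality of functions.\<close>

definition signed_measure :: "'a::topological_space set \<Rightarrow> ('a set \<Rightarrow> real) \<Rightarrow> bool" where
  "signed_measure T \<nu> \<longleftrightarrow>
     (\<forall>A. A \<notin> borel_sets T \<longrightarrow> \<nu> A = 0) \<and>
     (\<forall>A :: nat \<Rightarrow> 'a set. range A \<subseteq> borel_sets T \<longrightarrow> disjoint_family A \<longrightarrow>
        (\<lambda>i. \<nu> (A i)) sums \<nu> (\<Union>i. A i))"

text \<open>The supremum is over a bounded set: every real-valued signed measure has finite variation.\<close>

definition total_variation :: "'a::topological_space set \<Rightarrow> ('a set \<Rightarrow> real) \<Rightarrow> 'a set \<Rightarrow> real" where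
  "total_variation T \<nu> A =
     Sup {\<Sum>B\<in>P. \<bar>\<nu> B\<bar> |P. finite P \<and> P \<subseteq> borel_sets T \<and> partition_on A P}"

definition tv_norm :: "'a::topological_space set \<Rightarrow> ('a set \<Rightarrow> real) \<Rightarrow> real" where
  "tv_norm T \<nu> = total_variation T \<nu> T"

definition regular_measure :: "'a::topological_space set \<Rightarrow> ('a set \<Rightarrow> real) \<Rightarrow> bool" where
  "regular_measure T \<nu> \<longleftrightarrow>
     (\<forall>A\<in>borel_sets T. \<forall>e>0. \<exists>K U. closedin (top_of_set T) K \<and> openin (top_of_set T) U \<and>
        K \<subseteq> A \<and> A \<subseteq> U \<and> total_variation T \<nu> (U - K) < e)"

definition signed_measures :: "'a::topological_space set \<Rightarrow> ('a set \<Rightarrow> real) set" where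
  "signed_measures T = {\<nu>. signed_measure T \<nu> \<and> regular_measure T \<nu>}"

definition nonneg_measures :: "'a::topological_space set \<Rightarrow> ('a set \<Rightarrow> real) set" where
  "nonneg_measures T = {\<nu> \<in> signed_measures T. \<forall>A. 0 \<le> \<nu> A}"

text \<open>Integration against a signed measure goes through its Jordan decomposition.\<close>

definition pos_part :: "'a::topological_space set \<Rightarrow> ('a set \<Rightarrow> real) \<Rightarrow> 'a measure" where
  "pos_part T \<nu> =
     measure_of T (borel_sets T) (\<lambda>A. ennreal ((total_variation T \<nu> A + \<nu> A) / 2))"

definition neg_part :: "'a::topological_space set \<Rightarrow> ('a set \<Rightarrow> real) \<Rightarrow> 'a measure" where
  "neg_part T \<nu> =
     measure_of T (borel_sets T) (\<lambda>A. ennreal ((total_variation T \<nu> A - \<nu> A) / 2))"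

definition signed_integral ::
  "'a::topological_space set \<Rightarrow> ('a set \<Rightarrow> real) \<Rightarrow> ('a \<Rightarrow> 'b::{banach,second_countable_topology}) \<Rightarrow> 'b"
where
  "signed_integral T \<nu> h = integral\<^sup>L (pos_part T \<nu>) h - integral\<^sup>L (neg_part T \<nu>) h"

definition weak_star :: "'a::topological_space set \<Rightarrow> ('a set \<Rightarrow> real) topology" where
  "weak_star T = topology_generated_by
     {{\<nu> \<in> signed_measures T. signed_integral T \<nu> h \<in> U} |(h :: 'a \<Rightarrow> real) U.
        continuous_on T h \<and> open U}"

definition accumulation_point :: "'b topology \<Rightarrow> (nat \<Rightarrow> 'b) \<Rightarrow> 'b \<Rightarrow> bool" where
  "accumulation_point X w l \<longleftrightarrow>
     l \<in> topspace X \<and> (\<forall>U. openin X U \<longrightarrow> l \<in> U \<longrightarrow> infinite {k. w k \<in> U})"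

definition triple_topology ::
  "'a::topological_space set \<Rightarrow> ((real^'n) \<times> ('a set \<Rightarrow> real) \<times> (real^'m^'m)) topology" where
  "triple_topology T = prod_topology euclidean (prod_topology (weak_star T) (top_of_set sym_mats))"


definition grad :: "('b::real_inner \<Rightarrow> real) \<Rightarrow> 'b \<Rightarrow> 'b" where
  "grad f x = (THE D. GDERIV f x :> D)"

definition cont_differentiable :: "(real^'n \<Rightarrow> real) \<Rightarrow> bool" where
  "cont_differentiable f \<longleftrightarrow> (\<forall>x. f differentiable (at x)) \<and> continuous_on UNIV (grad f)"

definition affine_mat :: "real^'m^'m \<Rightarrow> ('n \<Rightarrow> real^'m^'m) \<Rightarrow> real^'n \<Rightarrow> real^'m^'m" where
  "affine_mat F0 F x = F0 + (\<Sum>i\<in>UNIV. x $ i *\<^sub>R F i)"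

definition feasible_set ::
  "'a set \<Rightarrow> (real^'n \<Rightarrow> 'a \<Rightarrow> real) \<Rightarrow> real^'m^'m \<Rightarrow> ('n \<Rightarrow> real^'m^'m) \<Rightarrow> (real^'n) set" where
  "feasible_set T g F0 F = {x. (\<forall>\<tau>\<in>T. g x \<tau> \<le> 0) \<and> affine_mat F0 F x \<in> psd_mats}"

definition is_optimum ::
  "'a set \<Rightarrow> (real^'n \<Rightarrow> real) \<Rightarrow> (real^'n \<Rightarrow> 'a \<Rightarrow> real) \<Rightarrow> real^'m^'m \<Rightarrow> ('n \<Rightarrow> real^'m^'m)
     \<Rightarrow> real^'n \<Rightarrow> bool" where
  "is_optimum T f g F0 F x \<longleftrightarrow>
     x \<in> feasible_set T g F0 F \<and> (\<forall>z\<in>feasible_set T g F0 F. f x \<le> f z)"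

definition slater ::
  "'a set \<Rightarrow> (real^'n \<Rightarrow> 'a \<Rightarrow> real) \<Rightarrow> real^'m^'m \<Rightarrow> ('n \<Rightarrow> real^'m^'m) \<Rightarrow> bool" where
  "slater T g F0 F \<longleftrightarrow> (\<exists>x. affine_mat F0 F x \<in> pd_mats \<and> (\<forall>\<tau>\<in>T. g x \<tau> < 0))"

text \<open>The supremum is a maximum when \<open>T\<close> is compact and nonempty and \<open>g x\<close> is continuous on \<open>T\<close>.\<close>

definition theta :: "'a set \<Rightarrow> (real^'n \<Rightarrow> 'a \<Rightarrow> real) \<Rightarrow> real^'n \<Rightarrow> real" where
  "theta T g x = (SUP \<tau>\<in>T. max (g x \<tau>) 0)"

definition phi1 ::
  "'a::topological_space set \<Rightarrow> (real^'n \<Rightarrow> real) \<Rightarrow> (real^'n \<Rightarrow> 'a \<Rightarrow> real) \<Rightarrow> ('n \<Rightarrow> real^'m^'m)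
     \<Rightarrow> real^'n \<Rightarrow> ('a set \<Rightarrow> real) \<Rightarrow> real^'m^'m \<Rightarrow> real^'n" where
  "phi1 T f g F x y V =
     grad f x + signed_integral T y (\<lambda>\<tau>. grad (\<lambda>z. g z \<tau>) x) - (\<chi> i. mat_inner (F i) V)"

definition phi2 ::
  "'a::topological_space set \<Rightarrow> (real^'n \<Rightarrow> 'a \<Rightarrow> real) \<Rightarrow> real^'n \<Rightarrow> ('a set \<Rightarrow> real) \<Rightarrow> real" where
  "phi2 T g x y = signed_integral T y (g x)"

definition phi3 ::
  "'m::{finite,linorder} sqmat \<Rightarrow> ('n \<Rightarrow> 'm sqmat) \<Rightarrow> real^'n \<Rightarrow> 'm sqmat \<Rightarrow> real
     \<Rightarrow> 'm \<times> 'm \<Rightarrow> real" where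
  "phi3 F0 F x V \<mu> = svec (jordan_prod (affine_mat F0 F x) V - \<mu> *\<^sub>R mat 1)"

definition residual ::
  "'a::topological_space set \<Rightarrow> (real^'n \<Rightarrow> real) \<Rightarrow> (real^'n \<Rightarrow> 'a \<Rightarrow> real)
     \<Rightarrow> 'm::{finite,linorder} sqmat \<Rightarrow> ('n \<Rightarrow> 'm sqmat)
     \<Rightarrow> real \<Rightarrow> real^'n \<Rightarrow> ('a set \<Rightarrow> real) \<Rightarrow> 'm sqmat \<Rightarrow> real" where
  "residual T f g F0 F \<mu> x y V =
     sqrt ((theta T g x)\<^sup>2 + (norm (phi1 T f g F x y V))\<^sup>2 + (phi2 T g x y)\<^sup>2
           + (svec_norm (phi3 F0 F x V \<mu>))\<^sup>2)"

definition neighbourhood ::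
  "'a::topological_space set \<Rightarrow> (real^'n \<Rightarrow> real) \<Rightarrow> (real^'n \<Rightarrow> 'a \<Rightarrow> real)
     \<Rightarrow> 'm::{finite,linorder} sqmat \<Rightarrow> ('n \<Rightarrow> 'm sqmat)
     \<Rightarrow> real \<Rightarrow> real \<Rightarrow> ((real^'n) \<times> ('a set \<Rightarrow> real) \<times> ('m sqmat)) set" where
  "neighbourhood T f g F0 F \<mu> \<epsilon> =
     {(x, y, V). y \<in> nonneg_measures T \<and> V \<in> pd_mats \<and>
        residual T f g F0 F \<mu> x y V \<le> \<epsilon> \<and> affine_mat F0 F x \<in> pd_mats}"

definition kkt_point ::
  "'a::topological_space set \<Rightarrow> (real^'n \<Rightarrow> real) \<Rightarrow> (real^'n \<Rightarrow> 'a \<Rightarrow> real)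
     \<Rightarrow> real^'m^'m \<Rightarrow> ('n \<Rightarrow> real^'m^'m)
     \<Rightarrow> real^'n \<Rightarrow> ('a set \<Rightarrow> real) \<Rightarrow> real^'m^'m \<Rightarrow> bool" where
  "kkt_point T f g F0 F x y V \<longleftrightarrow>
     grad f x + signed_integral T y (\<lambda>\<tau>. grad (\<lambda>z. g z \<tau>) x) - (\<chi> i. mat_inner (F i) V) = 0 \<and>
     jordan_prod (affine_mat F0 F x) V = 0 \<and> affine_mat F0 F x \<in> psd_mats \<and> V \<in> psd_mats \<and>
     signed_integral T y (g x) = 0 \<and> (\<forall>\<tau>\<in>T. g x \<tau> \<le> 0) \<and> y \<in> nonneg_measures T"

text \<open>An infinite run: the stopping test fails at every iterate, including the initial one, and
  every later iterate lies in the set prescribed by the current parameters.\<close>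

definition algorithm_run ::
  "'a::topological_space set \<Rightarrow> (real^'n \<Rightarrow> real) \<Rightarrow> (real^'n \<Rightarrow> 'a \<Rightarrow> real)
     \<Rightarrow> 'm::{finite,linorder} sqmat \<Rightarrow> ('n \<Rightarrow> 'm sqmat)
     \<Rightarrow> real \<Rightarrow> (nat \<Rightarrow> real) \<Rightarrow> (nat \<Rightarrow> real)
     \<Rightarrow> (nat \<Rightarrow> real^'n) \<Rightarrow> (nat \<Rightarrow> 'a set \<Rightarrow> real) \<Rightarrow> (nat \<Rightarrow> 'm sqmat) \<Rightarrow> bool" where
  "algorithm_run T f g F0 F \<beta> \<mu> \<epsilon> x y V \<longleftrightarrow>
     0 < \<beta> \<and> \<beta> < 1 \<and> 0 < \<mu> 0 \<and> 0 < \<epsilon> 0 \<and>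
     y 0 \<in> nonneg_measures T \<and> affine_mat F0 F (x 0) \<in> pd_mats \<and> V 0 \<in> pd_mats \<and>
     (\<forall>k. \<not> (residual T f g F0 F 0 (x k) (y k) (V k) = 0 \<and> affine_mat F0 F (x k) \<in> psd_mats \<and>
              V k \<in> psd_mats \<and> y k \<in> nonneg_measures T) \<and>
          (x (Suc k), y (Suc k), V (Suc k)) \<in> neighbourhood T f g F0 F (\<mu> k) (\<epsilon> k) \<and>
          \<mu> (Suc k) = \<beta> * \<mu> k \<and> \<epsilon> (Suc k) = \<beta> * \<epsilon> k)"

end

theory Submission
  imports Defs
begin

text \<open>All iterates from index 1 on are approximate KKT points whose residual bounds and
  perturbation parameters decay geometrically. Boundedness and the limit statement both follow from the Slater
  condition, convexity and compactness.

  Boundedness of \<open>x\<close>: the iterates violate \<open>g x \<tau> \<le> 0\<close> by at most \<open>\<epsilon> 0\<close>. Contracting such a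
  point towards a Slater point by a fixed factor makes it feasible by convexity, so compactness of
  the feasible set bounds the iterates (\<open>relaxed_feasible_set_bounded\<close>).

  Boundedness of the multipliers: the stationarity residual is paired with \<open>z - x\<close>, where \<open>z\<close> is a
  Slater point. Convexity of \<open>g\<close> in its first argument replaces the gradients by the differences
  \<open>g z \<tau> - g x \<tau>\<close>. This leaves the complementarity terms, which are small or bounded, and the
  terms \<open>mat_inner (affine_mat F0 F z) V\<close> and \<open>- signed_integral T y (g z)\<close>. These dominate
  positive multiples of \<open>trace V\<close> and \<open>y T\<close>, that is, of the sizes of both multipliers
  (\<open>stationarity_inequality\<close>, \<open>neighbourhoods_bounded\<close>). The matrix facts behind this come from
  writing a positive semidefinite matrix as a sum of outer products, obtained by symmetric
  elimination.

  Limits: an accumulation point is approached along suitable indices by \<open>x\<close>, by \<open>V\<close> and by the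
  integrals of finitely many test functions
  (\<open>accumulation_point_triple_sequence\<close>). The integrands in the KKT conditions vary with \<open>x\<close>, so
  they must depend continuously on \<open>(x, \<tau>)\<close> jointly. For the gradient of \<open>g\<close> this is a consequence
  of convexity, although only its continuity in \<open>x\<close> is assumed (\<open>continuous_on_grad_convex\<close>).
  With bounded masses the integrals then pass to the limit, and so do the KKT conditions
  (\<open>kkt_point_of_limit\<close>).

  Optimality: if \<open>f\<close> is convex, the same stationarity inequality with \<open>z\<close> feasible shows that a
  KKT point is a minimiser (\<open>kkt_point_is_optimum\<close>).\<close>

section \<open>Positive semidefinite matrices\<close>

definition outer :: "real^'m \<Rightarrow> real^'m^'m" where
  "outer v = (\<chi> i j. v $ i * v $ j)"

lemma norm_outer: "norm (outer v) = v \<bullet> v"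
proof -
  have row: "outer v $ i = v $ i *\<^sub>R v" for i
    by (simp add: outer_def vec_eq_iff)
  have "norm (outer v) = L2_set (\<lambda>i. \<bar>v $ i\<bar> * norm v) UNIV"
    by (simp only: norm_vec_def[of "outer v"] row norm_scaleR)
  also have "\<dots> = norm v * norm v"
    by (simp add: L2_set_left_distrib[symmetric] norm_vec_def)
  finally show ?thesis
    by (simp add: dot_square_norm power2_eq_square)
qed

lemma mat_inner_sum_entries: "mat_inner A B = (\<Sum>i\<in>UNIV. \<Sum>j\<in>UNIV. A $ i $ j * B $ j $ i)"
  by (simp add: mat_inner_def trace_def matrix_matrix_mult_def)

lemma mat_inner_outer: "mat_inner A (outer v) = v \<bullet> (A *v v)"
  by (simp add: mat_inner_sum_entries outer_def inner_vec_def matrix_vector_mult_def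
      sum_distrib_left algebra_simps)

lemma mat_inner_sum_right: "mat_inner A (\<Sum>k\<in>S. B k) = (\<Sum>k\<in>S. mat_inner A (B k))"
proof (induction S rule: infinite_finite_induct)
  case (insert k S)
  then show ?case
    by (simp add: mat_inner_sum_entries distrib_left sum.distrib)
qed (simp_all add: mat_inner_sum_entries)

lemma mat_inner_affine_mat:
  "mat_inner (affine_mat F0 F x) V = mat_inner F0 V + x \<bullet> (\<chi> i. mat_inner (F i) V)"
proof -
  have *: "mat_inner (A + B) V = mat_inner A V + mat_inner B V"
    and **: "mat_inner (c *\<^sub>R A) V = c * mat_inner A V" for A B c
    by (simp_all add: mat_inner_sum_entries distrib_right sum.distrib sum_distrib_left mult.assoc)
  have "mat_inner (\<Sum>i\<in>S. x $ i *\<^sub>R F i) V = (\<Sum>i\<in>S. x $ i * mat_inner (F i) V)" if "finite S" for S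
    using that
  proof (induction S rule: finite_induct)
    case empty
    then show ?case by (simp add: mat_inner_sum_entries)
  qed (simp add: * **)
  then show ?thesis
    by (simp add: affine_mat_def * inner_vec_def)
qed

lemma sym_mats_entry: "X \<in> sym_mats \<Longrightarrow> X $ i $ j = X $ j $ i"
  by (simp add: sym_mats_def transpose_def vec_eq_iff)

text \<open>Varying \<open>t\<close> here extracts information from positive semidefiniteness: a vanishing pivot
  \<open>X $ j $ j\<close> forces row \<open>j\<close> to vanish, and for a positive pivot the minimum over \<open>t\<close> is the
  quadratic form of the Schur complement.\<close>

lemma quadratic_form_shift_axis:
  assumes "X \<in> sym_mats"
  shows "(v + t *\<^sub>R axis j 1) \<bullet> (X *v (v + t *\<^sub>R axis j 1))
    = v \<bullet> (X *v v) + 2 * t * (X $ j \<bullet> v) + t\<^sup>2 * X $ j $ j"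
proof -
  have axis_diag: "axis j 1 \<bullet> X $ j = X $ j $ j"
    by (simp add: inner_axis')
  have col: "X *v axis j 1 = X $ j"
    using sym_mats_entry[OF assms]
    by (simp add: matrix_vector_mult_basis column_def vec_eq_iff)
  have row: "axis j 1 \<bullet> (X *v v) = X $ j \<bullet> v"
    by (simp add: inner_axis' matrix_vector_mul_component)
  show ?thesis
    by (simp add: matrix_vector_right_distrib matrix_vector_mult_scaleR inner_add_left
        inner_add_right col row axis_diag power2_eq_square inner_commute[of v] algebra_simps)
qed

lemma psd_zero_pivot:
  assumes X: "X \<in> psd_mats" and j: "X $ j $ j = 0"
  shows "X $ j = 0"
proof -
  have sym: "X \<in> sym_mats" and nn: "0 \<le> v \<bullet> (X *v v)" for v
    using X by (auto simp: psd_mats_def)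
  have nn': "0 \<le> v \<bullet> (X *v v) + 2 * t * (X $ j \<bullet> v)" for v t
    using nn[of "v + t *\<^sub>R axis j 1"] by (simp add: quadratic_form_shift_axis[OF sym] j)
  define b where "b = X $ j \<bullet> X $ j"
  define a where "a = X $ j \<bullet> (X *v (X $ j))"
  have "b = 0"
  proof (rule ccontr)
    (* The value of t below makes a + 2 * t * b equal to -1. *)
    assume "b \<noteq> 0"
    then have "0 \<le> a + 2 * (- (a + 1) / (2 * b)) * b"
      using nn'[of "X $ j" "- (a + 1) / (2 * b)"] by (simp add: a_def b_def)
    also have "\<dots> = - 1"
      using \<open>b \<noteq> 0\<close> by (simp add: field_simps)
    finally show False
      by simp
  qed
  then show ?thesis
    by (simp add: b_def)
qed

text \<open>Symmetric Gaussian elimination: subtracting the outer product of the scaled pivot row leaves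
  a positive semidefinite matrix (the Schur complement) with one more vanishing row.\<close>

lemma psd_sum_outer_aux:
  assumes "finite S" "X \<in> psd_mats" "\<And>i. i \<notin> S \<Longrightarrow> X $ i = 0"
  shows "\<exists>w. X = (\<Sum>j\<in>S. outer (w j))"
  using assms
proof (induction S arbitrary: X rule: finite_induct)
  case empty
  then show ?case by (simp add: vec_eq_iff)
next
  case (insert j S)
  have sym: "X \<in> sym_mats" and nn: "0 \<le> v \<bullet> (X *v v)" for v
    using insert.prems(1) by (auto simp: psd_mats_def)
  note entry = sym_mats_entry[OF sym]
  show ?case
  proof (cases "X $ j $ j = 0")
    case True
    then have "X $ i = 0" if "i \<notin> S" for i
      using psd_zero_pivot[OF insert.prems(1)] insert.prems(2) that by (cases "i = j") auto
    then obtain w where w: "X = (\<Sum>j\<in>S. outer (w j))"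
      using insert.IH[OF insert.prems(1)] by auto
    have "outer 0 = 0"
      by (simp add: outer_def vec_eq_iff)
    moreover have "(\<Sum>k\<in>S. outer ((w(j := 0)) k)) = X"
      using insert.hyps unfolding w by (intro sum.cong) auto
    ultimately have "X = (\<Sum>k\<in>insert j S. outer ((w(j := 0)) k))"
      using insert.hyps by simp
    then show ?thesis by blast
  next
    case False
    define p where "p = X $ j $ j"
    have "0 \<le> p"
      using nn[of "axis j 1"]
      by (simp add: p_def inner_axis' matrix_vector_mult_basis column_def)
    with False have p: "0 < p"
      by (simp add: p_def)
    define u where "u = (1 / sqrt p) *\<^sub>R X $ j"
    define Y where "Y = X - outer u"
    have outer_u: "outer u $ i $ k = X $ j $ i * X $ j $ k / p" for i k
      using p by (simp add: outer_def u_def real_sqrt_mult_self)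
    have "Y \<in> sym_mats"
      using entry by (simp add: Y_def sym_mats_def transpose_def vec_eq_iff outer_u mult.commute)
    moreover have "0 \<le> v \<bullet> (Y *v v)" for v
    proof -
      (* The minimiser of the quadratic form at v + t e_j, with e_j the j-th unit vector. *)
      let ?t = "- (X $ j \<bullet> v) / p"
      have "outer u *v v = (u \<bullet> v) *\<^sub>R u"
        by (simp add: vec_eq_iff outer_def matrix_vector_mult_def inner_vec_def
            sum_distrib_left algebra_simps)
      then have "v \<bullet> (Y *v v) = v \<bullet> (X *v v) - (u \<bullet> v)\<^sup>2"
        by (simp add: Y_def matrix_vector_mult_diff_rdistrib inner_diff_right inner_commute
            power2_eq_square)
      also have "(u \<bullet> v)\<^sup>2 = (X $ j \<bullet> v)\<^sup>2 / p"
        using p by (simp add: u_def power_divide)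
      also have "v \<bullet> (X *v v) - (X $ j \<bullet> v)\<^sup>2 / p
          = v \<bullet> (X *v v) + 2 * ?t * (X $ j \<bullet> v) + ?t\<^sup>2 * p"
        using p by (simp add: power2_eq_square field_simps)
      also have "\<dots> \<ge> 0"
        using nn[of "v + ?t *\<^sub>R axis j 1"]
        unfolding quadratic_form_shift_axis[OF sym] p_def .
      finally show ?thesis .
    qed
    ultimately have "Y \<in> psd_mats"
      by (simp add: psd_mats_def)
    moreover have "Y $ i = 0" if "i \<notin> S" for i
    proof (cases "i = j")
      case True
      then show ?thesis
        using p by (simp add: vec_eq_iff Y_def outer_u p_def)
    next
      case False
      then have "X $ i = 0"
        using insert.prems(2) that by simp
      then show ?thesis
        using entry[of j i] by (simp add: vec_eq_iff Y_def outer_u)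
    qed
    ultimately obtain w where w: "Y = (\<Sum>j\<in>S. outer (w j))"
      using insert.IH by blast
    have "(\<Sum>k\<in>S. outer ((w(j := u)) k)) = Y"
      using insert.hyps unfolding w by (intro sum.cong) auto
    then have "X = (\<Sum>k\<in>insert j S. outer ((w(j := u)) k))"
      using insert.hyps by (simp add: Y_def)
    then show ?thesis by blast
  qed
qed

lemma psd_sum_outer:
  fixes X :: "real^'m^'m"
  assumes "X \<in> psd_mats"
  obtains w :: "'m \<Rightarrow> real^'m" where "X = (\<Sum>j\<in>UNIV. outer (w j))"
  using psd_sum_outer_aux[OF finite assms, of UNIV] that by auto

text \<open>Writing \<open>X\<close> as a sum of outer products turns the inner product with \<open>A\<close> into a sum of values
  of the quadratic form of \<open>A\<close>, and \<open>trace X\<close> into the same sum for the identity.\<close>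

lemma mat_inner_psd_lower_bound:
  fixes X :: "real^'m^'m"
  assumes A: "\<And>v. l * (v \<bullet> v) \<le> v \<bullet> (A *v v)" and X: "X \<in> psd_mats"
  shows "l * trace X \<le> mat_inner A X"
proof -
  obtain w :: "'m \<Rightarrow> real^'m" where w: "X = (\<Sum>j\<in>UNIV. outer (w j))"
    using psd_sum_outer[OF X] .
  have "trace X = mat_inner (mat 1) X"
    by (simp add: mat_inner_def)
  then show ?thesis
    by (simp add: w mat_inner_sum_right mat_inner_outer sum_distrib_left sum_mono A)
qed

lemma norm_psd_le_trace:
  fixes X :: "real^'m^'m"
  assumes X: "X \<in> psd_mats"
  shows "norm X \<le> trace X"
proof -
  obtain w :: "'m \<Rightarrow> real^'m" where w: "X = (\<Sum>j\<in>UNIV. outer (w j))"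
    using psd_sum_outer[OF X] .
  have "trace X = mat_inner (mat 1) X"
    by (simp add: mat_inner_def)
  then have "trace X = (\<Sum>j\<in>UNIV. norm (outer (w j)))"
    by (simp add: w mat_inner_sum_right mat_inner_outer norm_outer)
  then show ?thesis
    unfolding w by (simp add: norm_sum)
qed

lemma mat_inner_psd_nonneg:
  assumes "A \<in> psd_mats" "X \<in> psd_mats"
  shows "0 \<le> mat_inner A X"
  using mat_inner_psd_lower_bound[of 0 A X] assms by (simp add: psd_mats_def)

lemma pd_subset_psd: "(pd_mats :: (real^'m^'m) set) \<subseteq> psd_mats"
proof
  fix A :: "real^'m^'m"
  assume A: "A \<in> pd_mats"
  have "0 \<le> v \<bullet> (A *v v)" for v
    using A by (cases "v = 0") (auto simp: pd_mats_def intro: less_imp_le)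
  with A show "A \<in> psd_mats"
    by (simp add: psd_mats_def pd_mats_def)
qed

text \<open>The constant is the minimum of the quadratic form on the compact unit sphere.\<close>

lemma pd_coercive:
  fixes A :: "real^'m^'m"
  assumes "A \<in> pd_mats"
  obtains l where "0 < l" "\<And>v. l * (v \<bullet> v) \<le> v \<bullet> (A *v v)"
proof -
  let ?q = "\<lambda>v::real^'m. v \<bullet> (A *v v)"
  have "continuous_on (sphere 0 1) ?q"
    by (intro continuous_intros)
  moreover have "sphere (0::real^'m) 1 \<noteq> {}"
    by simp
  ultimately obtain u where u: "u \<in> sphere 0 1" "\<And>v. v \<in> sphere 0 1 \<Longrightarrow> ?q u \<le> ?q v"
    using continuous_attains_inf[of "sphere 0 1" ?q] by auto
  show ?thesis
  proof
    have "u \<noteq> 0"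
      using u(1) by auto
    then show "0 < ?q u"
      using assms by (simp add: pd_mats_def)
    show "?q u * (v \<bullet> v) \<le> ?q v" for v
    proof (cases "v = 0")
      case False
      have "?q u \<le> ?q ((1 / norm v) *\<^sub>R v)"
        using False by (intro u(2)) simp
      also have "\<dots> = ?q v / (v \<bullet> v)"
        by (simp add: matrix_vector_mult_scaleR dot_square_norm power2_eq_square)
      finally show ?thesis
        using False by (simp add: field_simps)
    qed simp
  qed
qed

lemma psd_convex_combination:
  assumes "A \<in> psd_mats" "B \<in> psd_mats" "0 \<le> t" "t \<le> 1"
  shows "(1 - t) *\<^sub>R A + t *\<^sub>R B \<in> psd_mats"
proof -
  have "(1 - t) *\<^sub>R A + t *\<^sub>R B \<in> sym_mats"
    using assms by (simp add: psd_mats_def sym_mats_def transpose_def vec_eq_iff)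
  moreover have "0 \<le> v \<bullet> (((1 - t) *\<^sub>R A + t *\<^sub>R B) *v v)" for v
    using assms
    by (simp add: psd_mats_def matrix_vector_mult_add_rdistrib scaleR_matrix_vector_assoc[symmetric]
        inner_add_right)
  ultimately show ?thesis
    by (simp add: psd_mats_def)
qed

lemma affine_mat_convex_combination:
  "affine_mat F0 F ((1 - t) *\<^sub>R x + t *\<^sub>R z) = (1 - t) *\<^sub>R affine_mat F0 F x + t *\<^sub>R affine_mat F0 F z"
  by (simp add: affine_mat_def scaleR_add_right scaleR_sum_right scaleR_add_left sum.distrib
      left_diff_distrib scaleR_diff_left sum_subtractf)

lemma psd_mats_closed_sequentially:
  assumes X: "\<And>n. X n \<in> psd_mats" and lim: "X \<longlonglongrightarrow> L"
  shows "L \<in> psd_mats"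
proof -
  have entry: "(\<lambda>n. X n $ i $ j) \<longlonglongrightarrow> L $ i $ j" for i j
    by (intro tendsto_vec_nth lim)
  have "X n $ i $ j = X n $ j $ i" for n i j
    using X[of n] sym_mats_entry[of "X n"] by (simp add: psd_mats_def)
  then have "L $ i $ j = L $ j $ i" for i j
    using LIMSEQ_unique[OF entry[of i j]] entry[of j i] by simp
  moreover have "0 \<le> v \<bullet> (L *v v)" for v
  proof (rule LIMSEQ_le_const)
    show "(\<lambda>n. v \<bullet> (X n *v v)) \<longlonglongrightarrow> v \<bullet> (L *v v)"
      unfolding inner_vec_def matrix_vector_mult_def by (auto intro!: tendsto_intros entry)
    show "\<exists>N. \<forall>n\<ge>N. 0 \<le> v \<bullet> (X n *v v)"
      using X by (auto simp: psd_mats_def)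
  qed
  ultimately show ?thesis
    by (simp add: psd_mats_def sym_mats_def transpose_def vec_eq_iff)
qed

section \<open>The complementarity residual\<close>

lemma jordan_prod_symmetric:
  assumes "X \<in> sym_mats" "Y \<in> sym_mats"
  shows "jordan_prod X Y \<in> sym_mats"
  using assms
  by (simp add: sym_mats_def jordan_prod_def transpose_scalar matrix_transpose_mul[symmetric]
      transpose_def vec_eq_iff matrix_matrix_mult_def algebra_simps)

lemma trace_jordan_prod: "trace (jordan_prod X Y) = mat_inner X Y"
  using trace_mul_sym[of X Y]
  by (simp add: jordan_prod_def mat_inner_def trace_def sum.distrib sum_divide_distrib[symmetric])

lemma entry_le_svec_norm:
  fixes X :: "'m::{finite,linorder} sqmat"
  assumes "j \<le> i"
  shows "\<bar>X $ i $ j\<bar> \<le> svec_norm (svec X)"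
proof -
  have "\<bar>X $ i $ j\<bar> \<le> \<bar>svec X (i, j)\<bar>"
    using mult_right_mono[of 1 "sqrt 2" "\<bar>X $ i $ j\<bar>"] by (simp add: svec_def abs_mult)
  also have "\<dots> \<le> L2_set (\<lambda>p. \<bar>svec X p\<bar>) lower_triangle"
    using assms by (intro member_le_L2_set[of _ _ "\<lambda>p. \<bar>svec X p\<bar>"]) (simp_all add: lower_triangle_def)
  also have "\<dots> = svec_norm (svec X)"
    by (simp add: svec_norm_def L2_set_def)
  finally show ?thesis .
qed

text \<open>The trace of the Jordan product only involves diagonal entries, each of which exceeds \<open>\<mu>\<close>
  by at most the complementarity residual.\<close>

lemma mat_inner_le_svec_norm:
  fixes X V :: "'m::{finite,linorder} sqmat"
  shows "mat_inner X V \<le> CARD('m) * (\<mu> + svec_norm (svec (jordan_prod X V - \<mu> *\<^sub>R mat 1)))"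
proof -
  let ?J = "jordan_prod X V" and ?s = "svec_norm (svec (jordan_prod X V - \<mu> *\<^sub>R mat 1))"
  have "?J $ i $ i \<le> \<mu> + ?s" for i
    using entry_le_svec_norm[of i i "?J - \<mu> *\<^sub>R mat 1"] by (simp add: mat_def)
  then have "trace ?J \<le> (\<Sum>i\<in>(UNIV::'m set). \<mu> + ?s)"
    unfolding trace_def by (intro sum_mono)
  then show ?thesis
    by (simp add: trace_jordan_prod)
qed

section \<open>Gradients of convex functions\<close>

lemma GDERIV_grad:
  fixes f :: "'b::euclidean_space \<Rightarrow> real"
  assumes "f differentiable (at x)"
  shows "GDERIV f x :> grad f x"
proof -
  obtain f' where f': "(f has_derivative f') (at x)"
    using assms by (auto simp: differentiable_def)
  then have lin: "linear f'"
    by (rule has_derivative_linear)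
  have D: "GDERIV f x :> adjoint f' 1"
    using f' by (simp add: gderiv_def adjoint_works[OF lin])
  have "E = adjoint f' 1" if "GDERIV f x :> E" for E
  proof -
    have "(\<lambda>h. h \<bullet> E) = (\<lambda>h. h \<bullet> adjoint f' 1)"
      using has_derivative_unique D that unfolding gderiv_def by blast
    then show ?thesis
      by (metis vector_eq_ldot)
  qed
  with D show ?thesis
    unfolding grad_def by (rule theI)
qed

lemma grad_directional_derivative:
  fixes f :: "'b::euclidean_space \<Rightarrow> real"
  assumes "f differentiable (at x)"
  shows "((\<lambda>t. f (x + t *\<^sub>R v)) has_real_derivative grad f x \<bullet> v) (at 0)"
proof -
  have "(f has_derivative (\<lambda>h. h \<bullet> grad f x)) (at (x + 0 *\<^sub>R v))"
    using GDERIV_grad[OF assms] by (simp add: gderiv_def)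
  moreover have "((\<lambda>t. x + t *\<^sub>R v) has_derivative (\<lambda>t. t *\<^sub>R v)) (at 0)"
    by (auto intro!: derivative_eq_intros)
  ultimately have "((\<lambda>t. f (x + t *\<^sub>R v)) has_derivative (\<lambda>t. (t *\<^sub>R v) \<bullet> grad f x)) (at 0)"
    by (rule has_derivative_compose[rotated])
  then show ?thesis
    by (simp add: has_field_derivative_def inner_commute mult_commute_abs)
qed

lemma convex_grad_le:
  fixes f :: "'b::euclidean_space \<Rightarrow> real"
  assumes f: "convex_on UNIV f" and diff: "f differentiable (at x)"
  shows "grad f x \<bullet> (z - x) \<le> f z - f x"
proof -
  let ?\<phi> = "\<lambda>t. f (x + t *\<^sub>R (z - x))"
  have "convex_on UNIV ?\<phi>"
  proof (rule convex_onI)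
    fix t s r :: real
    assume "0 < t" "t < 1"
    have "x + ((1 - t) * s + t * r) *\<^sub>R (z - x)
        = (1 - t) *\<^sub>R (x + s *\<^sub>R (z - x)) + t *\<^sub>R (x + r *\<^sub>R (z - x))"
      by (simp add: algebra_simps)
    then show "?\<phi> ((1 - t) *\<^sub>R s + t *\<^sub>R r) \<le> (1 - t) * ?\<phi> s + t * ?\<phi> r"
      using convex_onD[OF f, of t "x + s *\<^sub>R (z - x)" "x + r *\<^sub>R (z - x)"] \<open>0 < t\<close> \<open>t < 1\<close> by simp
  qed simp
  then have "?\<phi> 1 - ?\<phi> 0 \<ge> (grad f x \<bullet> (z - x)) * (1 - 0)"
    using grad_directional_derivative[OF diff] by (intro convex_on_imp_above_tangent[of UNIV]) auto
  then show ?thesis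
    by simp
qed

text \<open>A convex function lies above its tangents, so its gradient in a direction \<open>v\<close> is bounded by
  every difference quotient with positive step along \<open>v\<close>. For a fixed step the quotient depends
  continuously on base point and parameter; a small step makes it close to the directional
  derivative at the limit. This gives upper semicontinuity in each direction, and the direction
  \<open>-v\<close> gives lower semicontinuity.\<close>

lemma continuous_on_grad_convex:
  fixes g :: "real^'n \<Rightarrow> 'a::metric_space \<Rightarrow> real"
  assumes cont: "continuous_on (UNIV \<times> T) (\<lambda>(z, \<tau>). g z \<tau>)"
    and convex: "\<And>\<tau>. \<tau> \<in> T \<Longrightarrow> convex_on UNIV (\<lambda>z. g z \<tau>)"
    and diff: "\<And>\<tau> z. \<tau> \<in> T \<Longrightarrow> (\<lambda>z. g z \<tau>) differentiable (at z)"
  shows "continuous_on (UNIV \<times> T) (\<lambda>(z, \<tau>). grad (\<lambda>z. g z \<tau>) z)"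
proof -
  let ?D = "\<lambda>p. grad (\<lambda>z. g z (snd p)) (fst p)"
  have upper: "\<forall>\<^sub>F p in at p0 within UNIV \<times> T. ?D p \<bullet> v < ?D p0 \<bullet> v + e"
    if p0: "p0 \<in> UNIV \<times> T" and e: "0 < e" for p0 v e
  proof -
    let ?q = "\<lambda>t p. (g (fst p + t *\<^sub>R v) (snd p) - g (fst p) (snd p)) / t"
    have "((\<lambda>t. ?q t p0) \<longlongrightarrow> ?D p0 \<bullet> v) (at 0)"
      using grad_directional_derivative[OF diff, of "snd p0" "fst p0" v] p0
      by (simp add: DERIV_def mem_Times_iff)
    then have "\<forall>\<^sub>F t in at_right 0. ?q t p0 < ?D p0 \<bullet> v + e"
      using e by (intro order_tendstoD[OF filterlim_mono[OF _ order_refl at_le]]) auto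
    then have "\<forall>\<^sub>F t in at_right 0. ?q t p0 < ?D p0 \<bullet> v + e \<and> 0 < t"
      using eventually_at_right_less by (rule eventually_conj)
    then obtain t where t: "?q t p0 < ?D p0 \<bullet> v + e" "0 < t"
      using eventually_happens trivial_limit_at_right_real by blast
    have shifted: "continuous_on (UNIV \<times> T) (\<lambda>p. g (fst p + s *\<^sub>R v) (snd p))" for s
    proof -
      have "continuous_on (UNIV \<times> T) (\<lambda>p. (fst p + s *\<^sub>R v, snd p))"
        by (intro continuous_intros)
      from continuous_on_compose2[OF cont this] show ?thesis
        by (simp add: image_subset_iff)
    qed
    have "continuous_on (UNIV \<times> T) (?q t)"
      using shifted[of t] shifted[of 0] \<open>0 < t\<close> by (auto intro!: continuous_intros)
    then have "(?q t \<longlongrightarrow> ?q t p0) (at p0 within UNIV \<times> T)"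
      using p0 unfolding continuous_on_def by (rule bspec)
    then have "\<forall>\<^sub>F p in at p0 within UNIV \<times> T. ?q t p < ?D p0 \<bullet> v + e"
      using t(1) by (rule order_tendstoD)
    moreover have "\<forall>\<^sub>F p in at p0 within UNIV \<times> T. p \<in> UNIV \<times> T"
      by (simp add: eventually_at_filter)
    ultimately show ?thesis
    proof eventually_elim
      case (elim p)
      then have "t * (?D p \<bullet> v) \<le> g (fst p + t *\<^sub>R v) (snd p) - g (fst p) (snd p)"
        using convex_grad_le[OF convex diff, of "snd p" "fst p" "fst p + t *\<^sub>R v"] by auto
      then have "?D p \<bullet> v \<le> ?q t p"
        using \<open>0 < t\<close> by (simp add: field_simps)
      then show ?case
        using elim by simp
    qed
  qed
  have "(?D \<longlongrightarrow> ?D p0) (at p0 within UNIV \<times> T)" if p0: "p0 \<in> UNIV \<times> T" for p0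
  proof (rule vec_tendstoI)
    fix i :: 'n
    have comp: "?D p $ i = ?D p \<bullet> axis i 1" for p
      by (simp add: inner_axis)
    show "((\<lambda>p. ?D p $ i) \<longlongrightarrow> ?D p0 $ i) (at p0 within UNIV \<times> T)"
    proof (rule order_tendstoI)
      fix a
      assume "?D p0 $ i < a"
      then show "\<forall>\<^sub>F p in at p0 within UNIV \<times> T. ?D p $ i < a"
        using upper[OF p0, of "a - ?D p0 $ i" "axis i 1"] by (simp add: comp)
    next
      fix a
      assume "a < ?D p0 $ i"
      then show "\<forall>\<^sub>F p in at p0 within UNIV \<times> T. a < ?D p $ i"
        using upper[OF p0, of "?D p0 $ i - a" "- axis i 1"] by (simp add: comp)
    qed
  qed
  then show ?thesis
    by (simp add: continuous_on_def case_prod_beta)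
qed

section \<open>Nonnegative measures\<close>

lemma borel_sets_simps [simp]:
  "T \<in> borel_sets T" "borel_sets T \<subseteq> Pow T" "sigma_sets T (borel_sets T) = borel_sets T"
proof -
  have space: "space (restrict_space borel T) = T"
    by (simp add: space_restrict_space)
  show "T \<in> borel_sets T"
    using sets.top[of "restrict_space borel T"] by (simp only: space)
  show "borel_sets T \<subseteq> Pow T"
    using sets.space_closed[of "restrict_space borel T"] by (simp only: space)
  show "sigma_sets T (borel_sets T) = borel_sets T"
    using sets.sigma_sets_eq[of "restrict_space borel T"] by (simp only: space)
qed

lemma nonneg_measuresD:
  assumes "y \<in> nonneg_measures T"
  shows "0 \<le> y A"
    and "\<And>A. range A \<subseteq> borel_sets T \<Longrightarrow> disjoint_family A \<Longrightarrow> (\<lambda>i. y (A i)) sums y (\<Union>i. A i)"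
    and "y {} = 0"
proof -
  show sums: "(\<lambda>i. y (A i)) sums y (\<Union>i. A i)"
    if "range A \<subseteq> borel_sets T" "disjoint_family A" for A
    using assms that by (auto simp: nonneg_measures_def signed_measures_def signed_measure_def)
  show "0 \<le> y A"
    using assms by (auto simp: nonneg_measures_def)
  (* A convergent series with constant terms has zero terms. *)
  have "(\<lambda>i::nat. y {}) sums y {}"
    using sums[of "\<lambda>_. {}"] by (simp add: disjoint_family_on_def)
  then have "summable (\<lambda>i::nat. y {})"
    by (rule sums_summable)
  then show "y {} = 0"
    by (simp add: summable_const_iff)
qed

context
  fixes T :: "'a::topological_space set" and y :: "'a set \<Rightarrow> real"
  assumes y: "y \<in> nonneg_measures T"
begin

lemma emeasure_measure_of_nonneg:
  assumes "A \<in> borel_sets T"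
  shows "emeasure (measure_of T (borel_sets T) (\<lambda>A. ennreal (y A))) A = ennreal (y A)"
proof (rule emeasure_measure_of[OF refl])
  show "positive (sets (measure_of T (borel_sets T) (\<lambda>A. ennreal (y A)))) (\<lambda>A. ennreal (y A))"
    by (simp add: positive_def nonneg_measuresD[OF y])
  show "countably_additive (sets (measure_of T (borel_sets T) (\<lambda>A. ennreal (y A)))) (\<lambda>A. ennreal (y A))"
  proof (rule countably_additiveI)
    fix A :: "nat \<Rightarrow> 'a set"
    assume "range A \<subseteq> sets (measure_of T (borel_sets T) (\<lambda>A. ennreal (y A)))" "disjoint_family A"
    then have "(\<lambda>i. y (A i)) sums y (\<Union>i. A i)"
      by (intro nonneg_measuresD[OF y]) auto
    then show "(\<Sum>i. ennreal (y (A i))) = ennreal (y (\<Union>i. A i))"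
      using nonneg_measuresD(1)[OF y] by (intro suminf_ennreal_eq) auto
  qed
qed (use assms in auto)

text \<open>A nonnegative set function that is a signed measure is its own total variation, so the
  negative part of its Jordan decomposition vanishes and integration against it is integration
  against an ordinary finite measure.\<close>

lemma total_variation_nonneg:
  assumes A: "A \<in> borel_sets T"
  shows "total_variation T y A = y A"
proof -
  define M where "M = measure_of T (borel_sets T) (\<lambda>A. ennreal (y A))"
  have sets: "sets M = borel_sets T" and space: "space M = T"
    by (simp_all add: M_def space_measure_of)
  have em: "emeasure M B = ennreal (y B)" if "B \<in> borel_sets T" for B
    using emeasure_measure_of_nonneg[OF that] by (simp add: M_def)
  have measure: "measure M B = y B" if "B \<in> borel_sets T" for B
    using em[OF that] nonneg_measuresD(1)[OF y] by (simp add: measure_def)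
  interpret finite_measure M
    by (rule finite_measureI) (simp add: space em)
  have sum: "(\<Sum>B\<in>P. \<bar>y B\<bar>) = y A"
    if P: "finite P" "P \<subseteq> borel_sets T" "partition_on A P" for P
  proof -
    have "measure M (\<Union>B\<in>P. B) = (\<Sum>B\<in>P. measure M B)"
      using P by (intro finite_measure_finite_Union)
        (auto simp: sets partition_on_def disjoint_family_on_def disjoint_def)
    moreover have "(\<Union>B\<in>P. B) = A"
      using P by (simp add: partition_on_def)
    moreover have "(\<Sum>B\<in>P. measure M B) = (\<Sum>B\<in>P. \<bar>y B\<bar>)"
      using P nonneg_measuresD(1)[OF y] by (intro sum.cong) (auto simp: measure)
    ultimately show ?thesis
      using A by (simp add: measure)
  qed
  have "\<exists>P. finite P \<and> P \<subseteq> borel_sets T \<and> partition_on A P"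
    using A by (intro exI[of _ "if A = {} then {} else {A}"]) (auto simp: partition_on_def)
  with sum have "{\<Sum>B\<in>P. \<bar>y B\<bar> |P. finite P \<and> P \<subseteq> borel_sets T \<and> partition_on A P} = {y A}"
    by (auto; metis)
  then show ?thesis
    by (simp add: total_variation_def)
qed

lemma pos_part_nonneg: "pos_part T y = measure_of T (borel_sets T) (\<lambda>A. ennreal (y A))"
  unfolding pos_part_def by (rule measure_of_eq) (simp_all add: total_variation_nonneg)

lemma sets_pos_part [simp]: "sets (pos_part T y) = borel_sets T"
  by (simp add: pos_part_def)

lemma space_pos_part [simp]: "space (pos_part T y) = T"
  by (simp add: pos_part_def space_measure_of)

lemma finite_measure_pos_part: "finite_measure (pos_part T y)"
  by (rule finite_measureI) (simp add: pos_part_nonneg space_measure_of emeasure_measure_of_nonneg)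

lemma measure_pos_part_total: "measure (pos_part T y) T = y T"
  using nonneg_measuresD(1)[OF y]
  by (simp add: pos_part_nonneg measure_def emeasure_measure_of_nonneg)

lemma signed_integral_nonneg:
  fixes h :: "'a \<Rightarrow> 'b::{banach,second_countable_topology}"
  shows "signed_integral T y h = integral\<^sup>L (pos_part T y) h"
proof -
  let ?N = "neg_part T y"
  have N: "?N = measure_of T (borel_sets T) (\<lambda>_. 0)"
    unfolding neg_part_def by (rule measure_of_eq) (simp_all add: total_variation_nonneg)
  have "emeasure ?N (space ?N) = 0"
    unfolding N by (rule emeasure_measure_of[OF refl])
      (simp_all add: positive_def countably_additive_def space_measure_of)
  then have "AE \<tau> in ?N. h \<tau> = 0"
    by (intro AE_I[of _ _ "space ?N"]) auto
  then show ?thesis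
    by (simp add: signed_integral_def integral_eq_zero_AE)
qed

lemma integrable_continuous_pos_part:
  fixes h :: "'a \<Rightarrow> 'b::{banach,second_countable_topology}"
  assumes T: "compact T" and h: "continuous_on T h"
  shows "integrable (pos_part T y) h"
proof -
  interpret finite_measure "pos_part T y"
    by (rule finite_measure_pos_part)
  obtain B where "\<And>\<tau>. \<tau> \<in> T \<Longrightarrow> norm (h \<tau>) \<le> B"
    using compact_imp_bounded[OF compact_continuous_image[OF h T]] by (auto simp: bounded_iff)
  moreover have "h \<in> borel_measurable (pos_part T y)"
    using borel_measurable_continuous_on_restrict[OF h]
    by (simp cong: measurable_cong_sets)
  ultimately show ?thesis
    by (intro integrable_const_bound[of _ B]) auto
qed

lemma signed_integral_mono:
  fixes h h' :: "'a \<Rightarrow> real"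
  assumes T: "compact T" and h: "continuous_on T h" "continuous_on T h'"
    and le: "\<And>\<tau>. \<tau> \<in> T \<Longrightarrow> h \<tau> \<le> h' \<tau>"
  shows "signed_integral T y h \<le> signed_integral T y h'"
  unfolding signed_integral_nonneg
  using le by (intro integral_mono integrable_continuous_pos_part T h) auto

lemma signed_integral_const: "signed_integral T y (\<lambda>_. c::real) = c * y T"
  by (simp add: signed_integral_nonneg measure_pos_part_total)

lemma signed_integral_diff:
  fixes h h' :: "'a \<Rightarrow> 'b::{banach,second_countable_topology}"
  assumes "compact T" "continuous_on T h" "continuous_on T h'"
  shows "signed_integral T y (\<lambda>\<tau>. h \<tau> - h' \<tau>) = signed_integral T y h - signed_integral T y h'"
  using assms by (simp add: signed_integral_nonneg integrable_continuous_pos_part)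

lemma signed_integral_inner:
  fixes h :: "'a \<Rightarrow> 'b::{real_inner,banach,second_countable_topology}"
  assumes "compact T" "continuous_on T h"
  shows "signed_integral T y (\<lambda>\<tau>. h \<tau> \<bullet> v) = signed_integral T y h \<bullet> v"
  using assms by (simp add: signed_integral_nonneg integrable_continuous_pos_part)

lemma norm_signed_integral_le:
  fixes h :: "'a \<Rightarrow> 'b::{banach,second_countable_topology}"
  assumes T: "compact T" and h: "continuous_on T h" and le: "\<And>\<tau>. \<tau> \<in> T \<Longrightarrow> norm (h \<tau>) \<le> c"
  shows "norm (signed_integral T y h) \<le> c * y T"
proof -
  have "norm (signed_integral T y h) \<le> signed_integral T y (\<lambda>\<tau>. norm (h \<tau>))"
    by (simp add: signed_integral_nonneg)
  also have "\<dots> \<le> signed_integral T y (\<lambda>_. c)"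
    using h le by (intro signed_integral_mono T continuous_intros) auto
  finally show ?thesis
    by (simp add: signed_integral_const)
qed

end

lemma tv_norm_nonneg:
  assumes "y \<in> nonneg_measures T"
  shows "tv_norm T y = y T"
  using total_variation_nonneg[OF assms] by (simp add: tv_norm_def)

section \<open>Weak* accumulation points\<close>

lemma openin_weak_star_ball:
  fixes h :: "'a::topological_space \<Rightarrow> real"
  assumes "continuous_on T h"
  shows "openin (weak_star T) {\<nu> \<in> signed_measures T. signed_integral T \<nu> h \<in> ball c e}"
  unfolding weak_star_def using assms open_ball by (intro topology_generated_by_Basis) blast

text \<open>The weak* topology need not be first countable, but only finitely many test functions are
  relevant at a time, and for these an accumulation point is a limit along suitable indices.\<close>

lemma accumulation_point_triple_sequence:
  fixes H :: "('a::topological_space \<Rightarrow> real) set"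
  assumes acc: "accumulation_point (triple_topology T) (\<lambda>k. (x k, y k, V k)) (xs, ys, Vs)"
    and H: "finite H" "\<And>h. h \<in> H \<Longrightarrow> continuous_on T h"
  obtains r :: "nat \<Rightarrow> nat" where "\<And>n. n < r n"
    and "(\<lambda>n. x (r n)) \<longlonglongrightarrow> xs" "(\<lambda>n. V (r n)) \<longlonglongrightarrow> Vs"
    and "\<And>h. h \<in> H \<Longrightarrow> (\<lambda>n. signed_integral T (y (r n)) h) \<longlonglongrightarrow> signed_integral T ys h"
proof -
  let ?I = "signed_integral T"
  have "(xs, ys, Vs) \<in> topspace (triple_topology T)"
    using acc by (simp add: accumulation_point_def)
  then have Vs: "Vs \<in> sym_mats" and ys: "ys \<in> signed_measures T"
    by (auto simp: triple_topology_def weak_star_def)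
  (* Inserting the zero test function keeps B e inside the space of signed measures even for
     empty H. *)
  define B where "B e = (\<Inter>h\<in>insert (\<lambda>_. 0) H. {\<nu> \<in> signed_measures T. ?I \<nu> h \<in> ball (?I ys h) e})"
    for e :: real
  define W where "W e = ball xs e \<times> (B e \<times> (sym_mats \<inter> ball Vs e))" for e
  have "\<exists>k>n. (x k, y k, V k) \<in> W (1 / Suc n)" for n
  proof -
    have "openin (weak_star T) (B (1 / Suc n))"
      unfolding B_def using H by (intro openin_INT2 openin_weak_star_ball) auto
    then have "openin (triple_topology T) (W (1 / Suc n))"
      by (simp add: W_def triple_topology_def openin_prod_Times_iff openin_open_Int
          flip: open_openin)
    moreover have "(xs, ys, Vs) \<in> W (1 / Suc n)"
      using Vs ys by (simp add: W_def B_def)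
    ultimately have "infinite {k. (x k, y k, V k) \<in> W (1 / Suc n)}"
      using acc by (simp add: accumulation_point_def)
    then show ?thesis
      by (simp add: infinite_nat_iff_unbounded)
  qed
  then obtain r where r: "\<And>n. n < r n" "\<And>n. (x (r n), y (r n), V (r n)) \<in> W (1 / Suc n)"
    by metis
  have small: "(\<lambda>n. 1 / real (Suc n)) \<longlonglongrightarrow> 0"
    using LIMSEQ_inverse_real_of_nat by (simp add: inverse_eq_divide)
  have lim: "u \<longlonglongrightarrow> l" if "\<And>n. dist (u n) l \<le> 1 / real (Suc n)" for u and l :: "'z::metric_space"
    using that by (intro metric_tendsto_imp_tendsto[OF small]) simp
  show ?thesis
  proof (rule that)
    show "(\<lambda>n. x (r n)) \<longlonglongrightarrow> xs" "(\<lambda>n. V (r n)) \<longlonglongrightarrow> Vs"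
      using r(2) by (auto intro!: lim less_imp_le simp: W_def dist_commute simp del: of_nat_Suc)
    show "(\<lambda>n. ?I (y (r n)) h) \<longlonglongrightarrow> ?I ys h" if "h \<in> H" for h
      using r(2) that by (auto intro!: lim less_imp_le simp: W_def B_def dist_commute simp del: of_nat_Suc)
  qed (rule r(1))
qed

text \<open>Since \<open>T\<close> is compact, moving the parameter \<open>zn\<close> to its limit changes the integrand
  uniformly little, and bounded masses carry this over to the integrals.\<close>

lemma tendsto_signed_integral_parameter:
  fixes h :: "'c::heine_borel \<Rightarrow> 'a::metric_space \<Rightarrow> 'b::{banach,second_countable_topology}"
  assumes T: "compact T" and h: "continuous_on (UNIV \<times> T) (\<lambda>(z, \<tau>). h z \<tau>)"
    and z: "zn \<longlonglongrightarrow> z" and y: "\<And>n. y n \<in> nonneg_measures T" "\<And>n. y n T \<le> C"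
    and lim: "(\<lambda>n. signed_integral T (y n) (h z)) \<longlonglongrightarrow> L"
  shows "(\<lambda>n. signed_integral T (y n) (h (zn n))) \<longlonglongrightarrow> L"
proof -
  have slice: "continuous_on T (h w)" for w
  proof -
    have "continuous_on T (\<lambda>\<tau>. (w, \<tau>))"
      by (intro continuous_intros)
    from continuous_on_compose2[OF h this] show ?thesis
      by (simp add: image_subset_iff)
  qed
  have "(\<lambda>n. signed_integral T (y n) (h (zn n)) - signed_integral T (y n) (h z)) \<longlonglongrightarrow> 0"
  proof (rule tendstoI)
    fix e :: real
    assume "0 < e"
    define K where "K = \<bar>C\<bar> + 1"
    define d where "d = e / (2 * K)"
    have K: "0 < K"
      by (simp add: K_def)
    then have "0 < d"
      using \<open>0 < e\<close> by (simp add: d_def)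
    have "compact (cball z 1 \<times> T)"
      using T by (intro compact_Times) auto
    moreover have "continuous_on (cball z 1 \<times> T) (\<lambda>(z, \<tau>). h z \<tau>)"
      using h by (rule continuous_on_subset) auto
    ultimately have "uniformly_continuous_on (cball z 1 \<times> T) (\<lambda>(z, \<tau>). h z \<tau>)"
      by (intro compact_uniformly_continuous)
    then obtain \<delta> where "0 < \<delta>"
      and \<delta>: "\<And>p q. p \<in> cball z 1 \<times> T \<Longrightarrow> q \<in> cball z 1 \<times> T \<Longrightarrow> dist q p < \<delta>
        \<Longrightarrow> dist (case q of (z, \<tau>) \<Rightarrow> h z \<tau>) (case p of (z, \<tau>) \<Rightarrow> h z \<tau>) < d"
      using \<open>0 < d\<close> unfolding uniformly_continuous_on_def by metis
    have "\<forall>\<^sub>F n in sequentially. dist (zn n) z < min \<delta> 1"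
      using z \<open>0 < \<delta>\<close> by (intro tendstoD) auto
    then show "\<forall>\<^sub>F n in sequentially.
        dist (signed_integral T (y n) (h (zn n)) - signed_integral T (y n) (h z)) 0 < e"
    proof eventually_elim
      case (elim n)
      have "norm (h (zn n) \<tau> - h z \<tau>) \<le> d" if "\<tau> \<in> T" for \<tau>
        using \<delta>[of "(z, \<tau>)" "(zn n, \<tau>)"] elim that
        by (simp add: dist_Pair_Pair dist_commute norm_minus_commute dist_norm[of "h _ _"])
      then have "norm (signed_integral T (y n) (\<lambda>\<tau>. h (zn n) \<tau> - h z \<tau>)) \<le> d * y n T"
        using slice by (intro norm_signed_integral_le y T continuous_intros) auto
      also have "\<dots> \<le> d * K"
        using y(2)[of n] \<open>0 < d\<close> by (intro mult_left_mono) (auto simp: K_def)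
      also have "\<dots> < e"
        using \<open>0 < e\<close> K by (simp add: d_def)
      finally show ?case
        by (simp add: signed_integral_diff[OF y(1) T slice slice])
    qed
  qed
  from tendsto_add[OF this lim] show ?thesis
    by simp
qed

section \<open>Bounds and limits for perturbed KKT points\<close>

locale convex_semi_infinite_sdp =
  fixes T :: "'a::metric_space set"
    and f :: "real^'n \<Rightarrow> real"
    and g :: "real^'n \<Rightarrow> 'a \<Rightarrow> real"
    and F0 :: "'m::{finite,linorder} sqmat"
    and F :: "'n \<Rightarrow> 'm sqmat"
  assumes T: "compact T"
    and f: "cont_differentiable f"
    and g_cont: "continuous_on (UNIV \<times> T) (\<lambda>(z, \<tau>). g z \<tau>)"
    and g_convex: "\<And>\<tau>. \<tau> \<in> T \<Longrightarrow> convex_on UNIV (\<lambda>z. g z \<tau>)"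
    and g_diff: "\<And>\<tau>. \<tau> \<in> T \<Longrightarrow> cont_differentiable (\<lambda>z. g z \<tau>)"
begin

lemma g_differentiable: "\<tau> \<in> T \<Longrightarrow> (\<lambda>z. g z \<tau>) differentiable (at z)"
  using g_diff by (simp add: cont_differentiable_def)

lemma continuous_on_g: "continuous_on T (g z)"
proof -
  have "continuous_on T (\<lambda>\<tau>. (z, \<tau>))"
    by (intro continuous_intros)
  from continuous_on_compose2[OF g_cont this] show ?thesis
    by (simp add: image_subset_iff)
qed

lemma continuous_on_grad_g_joint:
  "continuous_on (UNIV \<times> T) (\<lambda>(z, \<tau>). grad (\<lambda>z. g z \<tau>) z)"
  using g_cont g_convex g_differentiable by (rule continuous_on_grad_convex)

lemma continuous_on_grad_g: "continuous_on T (\<lambda>\<tau>. grad (\<lambda>z. g z \<tau>) z)"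
proof -
  have "continuous_on T (\<lambda>\<tau>. (z, \<tau>))"
    by (intro continuous_intros)
  from continuous_on_compose2[OF continuous_on_grad_g_joint this] show ?thesis
    by (simp add: image_subset_iff)
qed

lemma residual_bounds:
  assumes "residual T f g F0 F \<mu> x y V \<le> \<epsilon>"
  shows "\<And>\<tau>. \<tau> \<in> T \<Longrightarrow> g x \<tau> \<le> \<epsilon>" and "norm (phi1 T f g F x y V) \<le> \<epsilon>"
    and "\<bar>phi2 T g x y\<bar> \<le> \<epsilon>" and "svec_norm (phi3 F0 F x V \<mu>) \<le> \<epsilon>"
proof -
  let ?t = "theta T g x" and ?a = "norm (phi1 T f g F x y V)" and ?b = "phi2 T g x y"
    and ?c = "svec_norm (phi3 F0 F x V \<mu>)"
  have component: "\<bar>s\<bar> \<le> \<epsilon>" if "s\<^sup>2 \<le> ?t\<^sup>2 + ?a\<^sup>2 + ?b\<^sup>2 + ?c\<^sup>2" for s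
    using real_sqrt_le_mono[OF that] assms by (simp add: residual_def)
  have t: "\<bar>?t\<bar> \<le> \<epsilon>"
    by (rule component) simp
  show "norm (phi1 T f g F x y V) \<le> \<epsilon>" "\<bar>?b\<bar> \<le> \<epsilon>" "?c \<le> \<epsilon>"
    using component[of ?a] component[of ?b] component[of ?c] by simp_all
  have "bdd_above ((\<lambda>\<tau>. max (g x \<tau>) 0) ` T)"
    using T continuous_on_g
    by (intro compact_imp_bounded[THEN bounded_imp_bdd_above] compact_continuous_image
        continuous_intros)
  then have "max (g x \<tau>) 0 \<le> ?t" if "\<tau> \<in> T" for \<tau>
    unfolding theta_def using that by (intro cSUP_upper)
  then show "g x \<tau> \<le> \<epsilon>" if "\<tau> \<in> T" for \<tau>
    using t that by fastforce
qed

text \<open>Pairing the stationarity residual with \<open>z - x\<close> and using convexity under the integral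
  sign eliminates all gradients of \<open>g\<close>. With \<open>z\<close> a Slater point this bounds the multipliers; with
  \<open>z\<close> feasible it shows optimality of KKT points.\<close>

lemma stationarity_inequality:
  assumes y: "y \<in> nonneg_measures T"
  shows "mat_inner (affine_mat F0 F z) V - signed_integral T y (g z)
    \<le> (grad f x - phi1 T f g F x y V) \<bullet> (z - x) - phi2 T g x y + mat_inner (affine_mat F0 F x) V"
proof -
  let ?D = "\<lambda>\<tau>. grad (\<lambda>z. g z \<tau>) x" and ?w = "\<chi> i. mat_inner (F i) V"
  have "signed_integral T y ?D \<bullet> (z - x) = signed_integral T y (\<lambda>\<tau>. ?D \<tau> \<bullet> (z - x))"
    using signed_integral_inner[OF y T continuous_on_grad_g] by simp
  also have "\<dots> \<le> signed_integral T y (\<lambda>\<tau>. g z \<tau> - g x \<tau>)"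
    by (intro signed_integral_mono[OF y T] continuous_intros continuous_on_grad_g continuous_on_g
        convex_grad_le g_convex g_differentiable)
  also have "\<dots> = signed_integral T y (g z) - phi2 T g x y"
    using signed_integral_diff[OF y T continuous_on_g continuous_on_g] by (simp add: phi2_def)
  finally have "signed_integral T y ?D \<bullet> (z - x) \<le> signed_integral T y (g z) - phi2 T g x y" .
  moreover have "?w \<bullet> (z - x) = mat_inner (affine_mat F0 F z) V - mat_inner (affine_mat F0 F x) V"
    by (simp add: mat_inner_affine_mat inner_diff_left inner_commute[of ?w])
  ultimately show ?thesis
    by (simp add: phi1_def inner_diff_left inner_add_left)
qed

lemma slater_margin:
  assumes "slater T g F0 F"
  obtains z \<delta> where "affine_mat F0 F z \<in> pd_mats" "0 < \<delta>" "\<And>\<tau>. \<tau> \<in> T \<Longrightarrow> g z \<tau> \<le> - \<delta>"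
proof -
  obtain z where z: "affine_mat F0 F z \<in> pd_mats" "\<And>\<tau>. \<tau> \<in> T \<Longrightarrow> g z \<tau> < 0"
    using assms by (auto simp: slater_def)
  show ?thesis
  proof (cases "T = {}")
    case True
    then show ?thesis
      using z that[of z 1] by simp
  next
    case False
    then obtain \<sigma> where \<sigma>: "\<sigma> \<in> T" "\<And>\<tau>. \<tau> \<in> T \<Longrightarrow> g z \<tau> \<le> g z \<sigma>"
      using continuous_attains_sup[OF T _ continuous_on_g] by blast
    show ?thesis
      using z \<sigma> that[of z "- g z \<sigma>"] by simp
  qed
qed

text \<open>Shrinking a point that violates the constraints by at most \<open>\<epsilon>\<close> towards a Slater point with
  margin \<open>\<delta>\<close>, by the factor \<open>\<delta> / (\<delta> + \<epsilon>)\<close>, makes it feasible.\<close>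

lemma relaxed_feasible_set_bounded:
  assumes slater: "slater T g F0 F" and feasible: "bounded (feasible_set T g F0 F)" and \<epsilon>: "0 < \<epsilon>"
  shows "\<exists>B. \<forall>x. (\<forall>\<tau>\<in>T. g x \<tau> \<le> \<epsilon>) \<longrightarrow> affine_mat F0 F x \<in> psd_mats \<longrightarrow> norm x \<le> B"
proof -
  obtain z \<delta> where z: "affine_mat F0 F z \<in> pd_mats" "0 < \<delta>" "\<And>\<tau>. \<tau> \<in> T \<Longrightarrow> g z \<tau> \<le> - \<delta>"
    by (rule slater_margin[OF slater]) (rule that)
  obtain R where R: "\<And>u. u \<in> feasible_set T g F0 F \<Longrightarrow> norm u \<le> R"
    using feasible by (auto simp: bounded_iff)
  define t where "t = \<delta> / (\<delta> + \<epsilon>)"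
  have t: "0 < t" "t < 1"
    using z(2) \<epsilon> by (simp_all add: t_def)
  have t_balance: "(1 - t) * (- \<delta>) + t * \<epsilon> = 0"
    using z(2) \<epsilon> by (simp add: t_def field_simps)
  have "norm x \<le> (R + norm z) / t"
    if x: "\<And>\<tau>. \<tau> \<in> T \<Longrightarrow> g x \<tau> \<le> \<epsilon>" "affine_mat F0 F x \<in> psd_mats" for x
  proof -
    let ?u = "(1 - t) *\<^sub>R z + t *\<^sub>R x"
    have "g ?u \<tau> \<le> 0" if "\<tau> \<in> T" for \<tau>
    proof -
      have "g ?u \<tau> \<le> (1 - t) * g z \<tau> + t * g x \<tau>"
        using convex_onD[OF g_convex[OF that], of t z x] t by simp
      also have "\<dots> \<le> (1 - t) * (- \<delta>) + t * \<epsilon>"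
        using t z(3)[OF that] x(1)[OF that] by (intro add_mono mult_left_mono) auto
      finally show ?thesis
        using t_balance by simp
    qed
    moreover have "affine_mat F0 F ?u \<in> psd_mats"
      unfolding affine_mat_convex_combination
      using z(1) x(2) t pd_subset_psd by (intro psd_convex_combination) auto
    ultimately have "norm ?u \<le> R"
      by (intro R) (simp add: feasible_set_def)
    moreover have "t * norm x = norm (?u - (1 - t) *\<^sub>R z)"
      using t by simp
    moreover have "\<dots> \<le> norm ?u + (1 - t) * norm z"
      using t norm_triangle_ineq4[of ?u "(1 - t) *\<^sub>R z"] by simp
    moreover have "(1 - t) * norm z \<le> norm z"
      using t by (simp add: mult_left_le_one_le)
    ultimately show ?thesis
      using t by (simp add: pos_le_divide_eq mult.commute)
  qed
  then show ?thesis
    by blast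
qed

text \<open>In the stationarity inequality at a Slater point \<open>z\<close> with margin \<open>\<delta>\<close> the left side is at least
  \<open>l * trace V + \<delta> * y T\<close>, where \<open>l > 0\<close> is a coercivity constant of the matrix constraint at
  \<open>z\<close>, while the right side is controlled by the residual.\<close>

lemma neighbourhoods_bounded:
  assumes slater: "slater T g F0 F" and feasible: "bounded (feasible_set T g F0 F)" and \<epsilon>0: "0 < \<epsilon>0"
  obtains C where "\<And>\<mu> \<epsilon> x y V. \<mu> \<le> \<mu>0 \<Longrightarrow> \<epsilon> \<le> \<epsilon>0 \<Longrightarrow> (x, y, V) \<in> neighbourhood T f g F0 F \<mu> \<epsilon>
    \<Longrightarrow> norm x \<le> C \<and> y T \<le> C \<and> norm V \<le> C"
proof -
  obtain z \<delta> where z: "affine_mat F0 F z \<in> pd_mats" "0 < \<delta>" "\<And>\<tau>. \<tau> \<in> T \<Longrightarrow> g z \<tau> \<le> - \<delta>"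
    by (rule slater_margin[OF slater]) (rule that)
  obtain l where l: "0 < l" "\<And>v. l * (v \<bullet> v) \<le> v \<bullet> (affine_mat F0 F z *v v)"
    by (rule pd_coercive[OF z(1)]) (rule that)
  obtain B where B: "\<forall>x. (\<forall>\<tau>\<in>T. g x \<tau> \<le> \<epsilon>0) \<longrightarrow> affine_mat F0 F x \<in> psd_mats \<longrightarrow> norm x \<le> B"
    using relaxed_feasible_set_bounded[OF slater feasible \<epsilon>0] by blast
  have "compact (grad f ` cball 0 B)"
    using f by (intro compact_continuous_image) (auto simp: cont_differentiable_def
        intro: continuous_on_subset)
  then obtain G where G: "\<And>x. norm x \<le> B \<Longrightarrow> norm (grad f x) \<le> G"
    using compact_imp_bounded by (fastforce simp: bounded_iff)
  (* The terms of K bound, in this order, the pairing with z - x, the absolute value of phi2, and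
     mat_inner (affine_mat F0 F x) V. *)
  define K where "K = (G + \<epsilon>0) * (norm z + B) + \<epsilon>0 + CARD('m) * (\<mu>0 + \<epsilon>0)"
  have bounds: "norm x \<le> B \<and> y T \<le> K / \<delta> \<and> norm V \<le> K / l"
    if \<mu>: "\<mu> \<le> \<mu>0" and \<epsilon>: "\<epsilon> \<le> \<epsilon>0" and w: "(x, y, V) \<in> neighbourhood T f g F0 F \<mu> \<epsilon>"
    for \<mu> \<epsilon> x y V
  proof -
    have y: "y \<in> nonneg_measures T" and V: "V \<in> psd_mats" and res: "residual T f g F0 F \<mu> x y V \<le> \<epsilon>"
      and Fx: "affine_mat F0 F x \<in> psd_mats"
      using w pd_subset_psd by (auto simp: neighbourhood_def)
    note r = residual_bounds[OF res]
    have x: "norm x \<le> B"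
      using r(1) \<epsilon> Fx by (intro B[rule_format]) (auto intro: order_trans)
    have "(grad f x - phi1 T f g F x y V) \<bullet> (z - x)
        \<le> norm (grad f x - phi1 T f g F x y V) * norm (z - x)"
      by (rule norm_cauchy_schwarz)
    also have "\<dots> \<le> (G + \<epsilon>0) * (norm z + B)"
      using norm_triangle_ineq4[of "grad f x" "phi1 T f g F x y V"] norm_triangle_ineq4[of z x]
        G[OF x] r(2) \<epsilon> x by (intro mult_mono') auto
    finally have 1: "(grad f x - phi1 T f g F x y V) \<bullet> (z - x) \<le> (G + \<epsilon>0) * (norm z + B)" .
    have "mat_inner (affine_mat F0 F x) V \<le> CARD('m) * (\<mu> + svec_norm (phi3 F0 F x V \<mu>))"
      using mat_inner_le_svec_norm by (simp add: phi3_def)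
    also have "\<dots> \<le> CARD('m) * (\<mu>0 + \<epsilon>0)"
      using \<mu> \<epsilon> r(4) by (intro mult_left_mono) auto
    finally have 2: "mat_inner (affine_mat F0 F x) V \<le> CARD('m) * (\<mu>0 + \<epsilon>0)" .
    have 3: "signed_integral T y (g z) \<le> - \<delta> * y T"
      using signed_integral_mono[OF y T continuous_on_g continuous_on_const z(3)]
      by (simp add: signed_integral_const[OF y])
    have 4: "l * trace V \<le> mat_inner (affine_mat F0 F z) V"
      using mat_inner_psd_lower_bound[OF l(2) V] .
    have total: "l * trace V + \<delta> * y T \<le> K"
      using stationarity_inequality[OF y, of z V x] 1 2 3 4 r(3) \<epsilon> by (simp add: K_def)
    have nonneg: "0 \<le> y T" "0 \<le> trace V"
      using nonneg_measuresD(1)[OF y] order_trans[OF norm_ge_zero norm_psd_le_trace[OF V]] by auto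
    have "\<delta> * y T \<le> K" "l * trace V \<le> K"
      using total mult_nonneg_nonneg[of l "trace V"] mult_nonneg_nonneg[of \<delta> "y T"] nonneg l(1) z(2)
      by linarith+
    then have "y T \<le> K / \<delta>" "trace V \<le> K / l"
      using l(1) z(2) by (simp_all add: pos_le_divide_eq mult.commute)
    then show ?thesis
      using x norm_psd_le_trace[OF V] by simp
  qed
  show ?thesis
    by (rule that[of "max B (max (K / \<delta>) (K / l))"]) (use bounds in fastforce)
qed

text \<open>The integrals converge only for fixed integrands; the integrands at the moving points \<open>x n\<close>
  are handled by joint continuity of \<open>g\<close> and its gradient together with the mass bound. Hence
  convergence for the test functions \<open>g xs\<close> and the components of the gradient at \<open>xs\<close> suffices.\<close>

lemma kkt_point_of_limit:
  assumes w: "\<And>n. (x n, y n, V n) \<in> neighbourhood T f g F0 F (\<mu> n) (\<epsilon> n)"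
    and \<mu>: "\<mu> \<longlonglongrightarrow> 0" and \<epsilon>: "\<epsilon> \<longlonglongrightarrow> 0"
    and x: "x \<longlonglongrightarrow> xs" and V: "V \<longlonglongrightarrow> Vs"
    and ys: "ys \<in> nonneg_measures T" and mass: "\<And>n. y n T \<le> C"
    and lim_g: "(\<lambda>n. signed_integral T (y n) (g xs)) \<longlonglongrightarrow> signed_integral T ys (g xs)"
    and lim_D: "\<And>i. (\<lambda>n. signed_integral T (y n) (\<lambda>\<tau>. grad (\<lambda>z. g z \<tau>) xs $ i))
      \<longlonglongrightarrow> signed_integral T ys (\<lambda>\<tau>. grad (\<lambda>z. g z \<tau>) xs $ i)"
  shows "kkt_point T f g F0 F xs ys Vs"
proof -
  have y: "y n \<in> nonneg_measures T" and Vn: "V n \<in> psd_mats"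
    and res: "residual T f g F0 F (\<mu> n) (x n) (y n) (V n) \<le> \<epsilon> n"
    and Fx: "affine_mat F0 F (x n) \<in> psd_mats" for n
    using w[of n] pd_subset_psd by (auto simp: neighbourhood_def)
  note r = residual_bounds[OF res]
  have limit_zero: "L = 0" if "u \<longlonglongrightarrow> L" "\<And>n. norm (u n) \<le> \<epsilon> n" for u and L :: "'z::real_normed_vector"
    using LIMSEQ_unique[OF that(1) Lim_null_comparison[OF always_eventually \<epsilon>]] that(2) by blast
  have lim_F: "(\<lambda>n. affine_mat F0 F (x n)) \<longlonglongrightarrow> affine_mat F0 F xs"
    unfolding affine_mat_def by (intro tendsto_intros x)
  have F_psd: "affine_mat F0 F xs \<in> psd_mats" and V_psd: "Vs \<in> psd_mats"
    using psd_mats_closed_sequentially[OF Fx lim_F] psd_mats_closed_sequentially[OF Vn V] by auto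
  have g_le: "g xs \<tau> \<le> 0" if "\<tau> \<in> T" for \<tau>
  proof (rule LIMSEQ_le[OF _ \<epsilon>])
    have "isCont (\<lambda>z. g z \<tau>) xs"
      using g_differentiable[OF that] by (rule differentiable_imp_continuous_within)
    then show "(\<lambda>n. g (x n) \<tau>) \<longlonglongrightarrow> g xs \<tau>"
      using x by (rule isCont_tendsto_compose)
    show "\<exists>N. \<forall>n\<ge>N. g (x n) \<tau> \<le> \<epsilon> n"
      using r(1) that by blast
  qed
  have "(\<lambda>n. phi2 T g (x n) (y n)) \<longlonglongrightarrow> signed_integral T ys (g xs)"
    unfolding phi2_def using tendsto_signed_integral_parameter[OF T g_cont x y mass lim_g] .
  then have phi2: "signed_integral T ys (g xs) = 0"
    by (rule limit_zero) (simp add: r(3))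
  have "(\<lambda>n. signed_integral T (y n) (\<lambda>\<tau>. grad (\<lambda>z. g z \<tau>) xs))
      \<longlonglongrightarrow> signed_integral T ys (\<lambda>\<tau>. grad (\<lambda>z. g z \<tau>) xs)"
  proof (rule vec_tendstoI)
    fix i
    have "signed_integral T \<nu> (\<lambda>\<tau>. grad (\<lambda>z. g z \<tau>) xs) $ i
        = signed_integral T \<nu> (\<lambda>\<tau>. grad (\<lambda>z. g z \<tau>) xs $ i)" if "\<nu> \<in> nonneg_measures T" for \<nu>
      using signed_integral_inner[OF that T continuous_on_grad_g, of xs "axis i 1"]
      by (simp add: inner_axis)
    then show "(\<lambda>n. signed_integral T (y n) (\<lambda>\<tau>. grad (\<lambda>z. g z \<tau>) xs) $ i)
        \<longlonglongrightarrow> signed_integral T ys (\<lambda>\<tau>. grad (\<lambda>z. g z \<tau>) xs) $ i"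
      using lim_D[of i] y ys by simp
  qed
  then have "(\<lambda>n. signed_integral T (y n) (\<lambda>\<tau>. grad (\<lambda>z. g z \<tau>) (x n)))
      \<longlonglongrightarrow> signed_integral T ys (\<lambda>\<tau>. grad (\<lambda>z. g z \<tau>) xs)"
    by (rule tendsto_signed_integral_parameter[OF T continuous_on_grad_g_joint x y mass])
  moreover have "(\<lambda>n. grad f (x n)) \<longlonglongrightarrow> grad f xs"
    using f x by (auto simp: cont_differentiable_def continuous_on_eq_continuous_at
        intro: isCont_tendsto_compose)
  moreover have "(\<lambda>n. \<chi> i. mat_inner (F i) (V n)) \<longlonglongrightarrow> (\<chi> i. mat_inner (F i) Vs)"
    by (rule vec_tendstoI) (simp add: mat_inner_sum_entries, intro tendsto_intros V)
  ultimately have "(\<lambda>n. phi1 T f g F (x n) (y n) (V n)) \<longlonglongrightarrow> phi1 T f g F xs ys Vs"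
    unfolding phi1_def by (intro tendsto_add tendsto_diff)
  then have phi1: "phi1 T f g F xs ys Vs = 0"
    by (rule limit_zero) (rule r(2))
  let ?J = "jordan_prod (affine_mat F0 F xs) Vs"
  have lower: "?J $ i $ j = 0" if "j \<le> i" for i j
  proof -
    have "(\<lambda>n. (jordan_prod (affine_mat F0 F (x n)) (V n) - \<mu> n *\<^sub>R mat 1) $ i $ j)
        \<longlonglongrightarrow> (?J - 0 *\<^sub>R mat 1) $ i $ j"
      unfolding jordan_prod_def matrix_matrix_mult_def
      by (intro tendsto_intros lim_F V \<mu>)
    then have "(?J - 0 *\<^sub>R mat 1) $ i $ j = 0"
      by (rule limit_zero)
        (unfold real_norm_def, rule order_trans[OF entry_le_svec_norm[OF that] r(4)[unfolded phi3_def]])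
    then show ?thesis
      by simp
  qed
  have "?J \<in> sym_mats"
    using F_psd V_psd by (intro jordan_prod_symmetric) (auto simp: psd_mats_def)
  then have "?J = 0"
    using lower sym_mats_entry[of ?J] by (auto simp: vec_eq_iff) (metis linear)
  with phi1 phi2 F_psd V_psd g_le ys show ?thesis
    by (simp add: kkt_point_def phi1_def)
qed

text \<open>At a KKT point the residual terms in the stationarity inequality vanish, and for feasible
  \<open>z\<close> its left side is nonnegative. So the derivative of \<open>f\<close> towards every feasible point is
  nonnegative.\<close>

lemma kkt_point_is_optimum:
  assumes kkt: "kkt_point T f g F0 F x y V" and convex: "convex_on UNIV f"
  shows "is_optimum T f g F0 F x"
proof -
  have y: "y \<in> nonneg_measures T" and V: "V \<in> psd_mats"
    and phi1: "phi1 T f g F x y V = 0" and phi2: "phi2 T g x y = 0"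
    using kkt by (auto simp: kkt_point_def phi1_def phi2_def)
  have "mat_inner (affine_mat F0 F x) V = trace (0 :: 'm sqmat)"
    using kkt by (simp add: kkt_point_def flip: trace_jordan_prod)
  then have complementary: "mat_inner (affine_mat F0 F x) V = 0"
    by (simp add: trace_def)
  have "f x \<le> f z" if z: "z \<in> feasible_set T g F0 F" for z
  proof -
    have "0 \<le> mat_inner (affine_mat F0 F z) V"
      using z V by (intro mat_inner_psd_nonneg) (auto simp: feasible_set_def)
    moreover have "signed_integral T y (g z) \<le> 0"
      using signed_integral_mono[OF y T continuous_on_g continuous_on_const, of z 0] z
      by (auto simp: feasible_set_def signed_integral_const[OF y])
    ultimately have "0 \<le> grad f x \<bullet> (z - x)"
      using stationarity_inequality[OF y, of z V x] by (simp add: phi1 phi2 complementary)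
    also have "\<dots> \<le> f z - f x"
      using f by (intro convex_grad_le convex) (simp add: cont_differentiable_def)
    finally show ?thesis
      by simp
  qed
  then show ?thesis
    using kkt by (simp add: is_optimum_def feasible_set_def kkt_point_def)
qed

end

section \<open>Convergence of the algorithm\<close>

theorem theorem2:
  fixes T :: "'a::metric_space set"
    and f :: "real^'n \<Rightarrow> real"
    and g :: "real^'n \<Rightarrow> 'a \<Rightarrow> real"
    and F0 :: "'m::{finite,linorder} sqmat"
    and F :: "'n \<Rightarrow> 'm sqmat"
    and \<beta> :: real
    and \<mu> \<epsilon> :: "nat \<Rightarrow> real"
    and x :: "nat \<Rightarrow> real^'n"
    and y :: "nat \<Rightarrow> 'a set \<Rightarrow> real"
    and V :: "nat \<Rightarrow> 'm sqmat"
  assumes T: "compact T" "T \<noteq> {}"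
    and f: "cont_differentiable f"
    and g_cont: "continuous_on (UNIV \<times> T) (\<lambda>(z, \<tau>). g z \<tau>)"
    and g_convex: "\<And>\<tau>. \<tau> \<in> T \<Longrightarrow> convex_on UNIV (\<lambda>z. g z \<tau>)"
    and g_diff: "\<And>\<tau>. \<tau> \<in> T \<Longrightarrow> cont_differentiable (\<lambda>z. g z \<tau>)"
    and F: "F0 \<in> sym_mats" "\<And>i. F i \<in> sym_mats"
    and solvable: "\<exists>z. is_optimum T f g F0 F z"
    and A1: "feasible_set T g F0 F \<noteq> {}" "compact (feasible_set T g F0 F)"
    and A2: "slater T g F0 F"
    and run: "algorithm_run T f g F0 F \<beta> \<mu> \<epsilon> x y V"
  shows "(\<exists>C. \<forall>k. norm (x k) \<le> C \<and> tv_norm T (y k) \<le> C \<and> norm (V k) \<le> C) \<and>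
    (\<forall>xs ys Vs. ys \<in> nonneg_measures T \<longrightarrow> Vs \<in> sym_mats \<longrightarrow>
       accumulation_point (triple_topology T) (\<lambda>k. (x k, y k, V k)) (xs, ys, Vs) \<longrightarrow>
       kkt_point T f g F0 F xs ys Vs \<and>
       (convex_on UNIV f \<longrightarrow> is_optimum T f g F0 F xs))"
proof -
  interpret convex_semi_infinite_sdp T f g F0 F
    using T f g_cont g_convex g_diff by unfold_locales auto
  have \<beta>: "0 < \<beta>" "\<beta> < 1" and pos: "0 < \<mu> 0" "0 < \<epsilon> 0" and y0: "y 0 \<in> nonneg_measures T"
    and step: "(x (Suc k), y (Suc k), V (Suc k)) \<in> neighbourhood T f g F0 F (\<mu> k) (\<epsilon> k)"
    and rec: "\<mu> (Suc k) = \<beta> * \<mu> k" "\<epsilon> (Suc k) = \<beta> * \<epsilon> k" for k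
    using run by (auto simp: algorithm_run_def)
  have \<mu>: "\<mu> k = \<beta> ^ k * \<mu> 0" and \<epsilon>: "\<epsilon> k = \<beta> ^ k * \<epsilon> 0" for k
    by (induction k) (simp_all add: rec)
  have le: "\<beta> ^ k * c \<le> c" if "0 < c" for k c
    using \<beta> that by (simp add: mult_left_le_one_le power_le_one)
  have "bounded (feasible_set T g F0 F)"
    using A1(2) by (rule compact_imp_bounded)
  then obtain C where C: "\<And>\<mu>' \<epsilon>' x y V. \<mu>' \<le> \<mu> 0 \<Longrightarrow> \<epsilon>' \<le> \<epsilon> 0
      \<Longrightarrow> (x, y, V) \<in> neighbourhood T f g F0 F \<mu>' \<epsilon>' \<Longrightarrow> norm x \<le> C \<and> y T \<le> C \<and> norm V \<le> C"
    using neighbourhoods_bounded[OF A2 _ pos(2), of "\<mu> 0"] by metis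
  have bounds: "norm (x (Suc k)) \<le> C \<and> y (Suc k) T \<le> C \<and> norm (V (Suc k)) \<le> C" for k
    using le[OF pos(1), of k] le[OF pos(2), of k] by (intro C[OF _ _ step[of k]]) (simp_all add: \<mu>[of k] \<epsilon>[of k])
  have y_nonneg: "y k \<in> nonneg_measures T" for k
    using y0 step by (cases k) (auto simp: neighbourhood_def)
  define C' where "C' = Max {C, norm (x 0), y 0 T, norm (V 0)}"
  have "norm (x k) \<le> C' \<and> tv_norm T (y k) \<le> C' \<and> norm (V k) \<le> C'" for k
  proof (cases k)
    case 0
    then show ?thesis
      by (simp add: C'_def tv_norm_nonneg y0 le_max_iff_disj)
  next
    case (Suc l)
    have "C \<le> C'"
      by (simp add: C'_def)
    then show ?thesis
      using bounds[of l] by (auto simp: Suc tv_norm_nonneg y_nonneg)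
  qed
  moreover have kkt: "kkt_point T f g F0 F xs ys Vs"
    if ys: "ys \<in> nonneg_measures T"
      and acc: "accumulation_point (triple_topology T) (\<lambda>k. (x k, y k, V k)) (xs, ys, Vs)"
    for xs ys Vs
  proof -
    let ?D = "\<lambda>i \<tau>. grad (\<lambda>z. g z \<tau>) xs $ i"
    have test: "continuous_on T h" if "h \<in> insert (g xs) (range ?D)" for h
      using that continuous_on_g continuous_on_grad_g by (auto intro!: continuous_intros)
    obtain r where r: "\<And>n. n < r n"
      and lim: "(\<lambda>n. x (r n)) \<longlonglongrightarrow> xs" "(\<lambda>n. V (r n)) \<longlonglongrightarrow> Vs"
      and lim_int: "\<And>h. h \<in> insert (g xs) (range ?D)
        \<Longrightarrow> (\<lambda>n. signed_integral T (y (r n)) h) \<longlonglongrightarrow> signed_integral T ys h"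
      by (rule accumulation_point_triple_sequence[OF acc _ test, of "insert (g xs) (range ?D)"])
        (simp, assumption, rule that)
    (* Iterate number r n was computed with the parameters of the preceding index s n. *)
    define s where "s n = r n - 1" for n
    have s: "r n = Suc (s n)" "n \<le> s n" for n
      using r[of n] by (simp_all add: s_def)
    have geometric: "(\<lambda>n. \<beta> ^ s n * c) \<longlonglongrightarrow> 0" if "0 < c" for c
    proof (rule tendsto_sandwich[of "\<lambda>_. 0"])
      show "\<forall>\<^sub>F n in sequentially. \<beta> ^ s n * c \<le> \<beta> ^ n * c"
        using \<beta> that s(2) by (intro always_eventually allI mult_right_mono power_decreasing) auto
      show "(\<lambda>n. \<beta> ^ n * c) \<longlonglongrightarrow> 0"
        using \<beta> by (intro tendsto_mult_left_zero LIMSEQ_realpow_zero) auto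
    qed (use \<beta> that in auto)
    show ?thesis
    proof (rule kkt_point_of_limit)
      show "(x (r n), y (r n), V (r n)) \<in> neighbourhood T f g F0 F (\<mu> (s n)) (\<epsilon> (s n))" for n
        using step by (simp add: s(1))
      show "y (r n) T \<le> C" for n
        using bounds by (simp add: s(1))
      show "(\<lambda>n. \<mu> (s n)) \<longlonglongrightarrow> 0" "(\<lambda>n. \<epsilon> (s n)) \<longlonglongrightarrow> 0"
        using geometric[OF pos(1)] geometric[OF pos(2)] by (simp_all flip: \<mu> \<epsilon>)
    qed (use lim lim_int ys in auto)
  qed
  ultimately show ?thesis
    using kkt_point_is_optimum by blast
qed

end
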